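(* Let $t \in \{5,6\}$. Every connected $P_t$-free graph $G$ satisfies $\mathsf{lpt}(G) \le t-2$.
   Context: All graphs are finite and simple. $P_t$ is the chordless path on $t$ vertices; a graph is $P_t$-free if it has no induced subgraph isomorphic to $P_t$. A longest path of a connected graph $G$ is a path of maximum length in $G$; a longest path transversal is a set of vertices meeting every longest path; $\mathsf{lpt}(G)$ is the minimum cardinality of a longest path transversal of $G$. *)

theory Defs
  imports Main
begin

definition simple_graph :: "'a set \<Rightarrow> ('a \<Rightarrow> 'a \<Rightarrow> bool) \<Rightarrow> bool" where
  "simple_graph V E \<longleftrightarrow> finite V \<and> (\<forall>x y. E x y \<longrightarrow> x \<in> V \<and> y \<in> V)
     \<and> (\<forall>x y. E x y \<longrightarrow> E y x) \<and> (\<forall>x. \<not> E x x)"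

text \<open>A path is a nonempty list of distinct vertices, consecutive ones adjacent.
Its length is the number of edges, i.e. length p - 1.\<close>
definition is_path :: "'a set \<Rightarrow> ('a \<Rightarrow> 'a \<Rightarrow> bool) \<Rightarrow> 'a list \<Rightarrow> bool" where
  "is_path V E p \<longleftrightarrow> p \<noteq> [] \<and> distinct p \<and> set p \<subseteq> V
     \<and> (\<forall>i. Suc i < length p \<longrightarrow> E (p ! i) (p ! Suc i))"

definition connected_graph :: "'a set \<Rightarrow> ('a \<Rightarrow> 'a \<Rightarrow> bool) \<Rightarrow> bool" where
  "connected_graph V E \<longleftrightarrow> V \<noteq> {} \<and>
     (\<forall>u\<in>V. \<forall>v\<in>V. \<exists>p. is_path V E p \<and> hd p = u \<and> last p = v)"

definition has_induced_path :: "nat \<Rightarrow> 'a set \<Rightarrow> ('a \<Rightarrow> 'a \<Rightarrow> bool) \<Rightarrow> bool" where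
  "has_induced_path t V E \<longleftrightarrow> (\<exists>p. length p = t \<and> distinct p \<and> set p \<subseteq> V
     \<and> (\<forall>i<t. \<forall>j<t. E (p ! i) (p ! j) \<longleftrightarrow> (i = Suc j \<or> j = Suc i)))"

definition P_free :: "nat \<Rightarrow> 'a set \<Rightarrow> ('a \<Rightarrow> 'a \<Rightarrow> bool) \<Rightarrow> bool" where
  "P_free t V E \<longleftrightarrow> \<not> has_induced_path t V E"

definition longest_path :: "'a set \<Rightarrow> ('a \<Rightarrow> 'a \<Rightarrow> bool) \<Rightarrow> 'a list \<Rightarrow> bool" where
  "longest_path V E p \<longleftrightarrow> is_path V E p \<and> (\<forall>q. is_path V E q \<longrightarrow> length q \<le> length p)"

definition lp_transversal :: "'a set \<Rightarrow> ('a \<Rightarrow> 'a \<Rightarrow> bool) \<Rightarrow> 'a set \<Rightarrow> bool" where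
  "lp_transversal V E S \<longleftrightarrow> S \<subseteq> V \<and> (\<forall>p. longest_path V E p \<longrightarrow> set p \<inter> S \<noteq> {})"

definition lpt :: "'a set \<Rightarrow> ('a \<Rightarrow> 'a \<Rightarrow> bool) \<Rightarrow> nat" where
  "lpt V E = (LEAST k. \<exists>S. lp_transversal V E S \<and> card S = k)"

end

theory Submission
  imports Defs
begin

text \<open>
  For a connected set \<open>S\<close> let \<open>D\<close> be a component of \<open>G - N[S]\<close> containing a longest path \<open>R\<close> of
  \<open>G - N[S]\<close>. If some \<open>w \<in> N(S)\<close> is complete to \<open>D\<close>, then \<open>S \<union> {w}\<close> meets every longest path: a
  longest path \<open>P\<close> missing it must avoid \<open>D\<close>, since \<open>w\<close>, possibly followed by a path in \<open>S\<close>, could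
  be inserted after a vertex of \<open>P\<close> in \<open>D\<close>; but then the initial segment of \<open>P\<close> outside \<open>N[S]\<close>,
  which is not longer than \<open>R\<close>, can be exchanged for \<open>R\<close>, \<open>w\<close> and a path in \<open>S\<close>.

  Hence it suffices to find a connected \<open>S\<close> with at most \<open>t - 3\<close> vertices which is dominating or
  has such a \<open>w\<close>. If there is none, choose \<open>S\<close> minimising first the length of \<open>R\<close> and then the
  number of vertices in components of \<open>G - N[S]\<close> that contain a path of this length. A vertex \<open>w\<close>
  attached to \<open>D\<close> is not complete to it, so there is an edge \<open>x d\<close> in \<open>D\<close> with \<open>w\<close> adjacent to \<open>x\<close>
  only. Let \<open>Q\<close> be the induced path \<open>x w\<close> if \<open>t = 5\<close> and \<open>d x w\<close> if \<open>t = 6\<close>. If \<open>\<sigma> \<in> S\<close> is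
  attached to a component \<open>F\<close> of \<open>G - N[Q]\<close> containing a longest path of \<open>G - N[Q]\<close>, then \<open>w\<close> is
  the only neighbour of \<open>\<sigma>\<close> on \<open>Q\<close> and \<open>\<sigma>\<close> is mixed on an edge \<open>y y'\<close> of \<open>F\<close>, so \<open>Q \<sigma> y y'\<close> is an
  induced \<open>P\<^sub>t\<close>. Thus \<open>F\<close> avoids \<open>N[S]\<close>, and as \<open>x\<close> lies in \<open>D\<close> but in no such \<open>F\<close>, the vertex set
  of \<open>Q\<close> beats \<open>S\<close>.
\<close>

subsection \<open>Paths\<close>

lemma is_path_successively:
  "is_path V E p \<longleftrightarrow> p \<noteq> [] \<and> distinct p \<and> set p \<subseteq> V \<and> successively E p"
  by (auto simp: is_path_def successively_conv_nth)

lemma is_path_singleton: "v \<in> V \<Longrightarrow> is_path V E [v]"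
  by (simp add: is_path_def)

lemma is_path_mono: "is_path U E p \<Longrightarrow> set p \<subseteq> W \<Longrightarrow> is_path W E p"
  by (auto simp: is_path_def)

lemma is_path_append:
  assumes "is_path V E p" "is_path V E q" "set p \<inter> set q = {}" "E (last p) (hd q)"
  shows "is_path V E (p @ q)"
  using assms by (auto simp: is_path_successively successively_append_iff)

lemma is_path_prefix: "is_path V E (p @ q) \<Longrightarrow> p \<noteq> [] \<Longrightarrow> is_path V E p"
  by (auto simp: is_path_successively successively_append_iff)

lemma is_path_length_le_card: "finite U \<Longrightarrow> is_path U E p \<Longrightarrow> length p \<le> card U"
  using card_mono[of U "set p"] by (simp add: is_path_def distinct_card)

lemma longest_path_exists:
  assumes "finite U" "U \<noteq> {}"
  shows "\<exists>p. longest_path U E p"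
proof -
  obtain v where "is_path U E [v]" using assms(2) is_path_singleton by fastforce
  moreover have "\<forall>p. is_path U E p \<longrightarrow> length p < Suc (card U)"
    using is_path_length_le_card[OF assms(1)] less_Suc_eq_le by blast
  ultimately show ?thesis
    unfolding longest_path_def
    using ex_has_greatest_nat[of "is_path U E" "[v]" length] by blast
qed

lemma longest_path_exchange:
  assumes longest: "longest_path V E (A @ B @ C)"
    and T: "is_path V E T" "set T \<inter> (set A \<union> set C) = {}"
    and links: "A \<noteq> [] \<Longrightarrow> E (last A) (hd T)" "C \<noteq> [] \<Longrightarrow> E (last T) (hd C)"
  shows "length T \<le> length B"
proof -
  have "is_path V E (A @ B @ C)" using longest by (simp add: longest_path_def)
  then have "is_path V E (A @ T @ C)"
    using T links by (auto simp: is_path_successively successively_append_iff)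
  then have "length (A @ T @ C) \<le> length (A @ B @ C)"
    using longest by (simp only: longest_path_def)
  then show ?thesis by simp
qed

lemma path_split_at_exit:
  assumes P: "is_path V E P" and R: "longest_path U E R"
  obtains A B where "P = A @ B" "length A \<le> length R" "B = [] \<or> hd B \<notin> U"
proof
  let ?A = "takeWhile (\<lambda>v. v \<in> U) P" and ?B = "dropWhile (\<lambda>v. v \<in> U) P"
  show "P = ?A @ ?B" by simp
  show "length ?A \<le> length R"
  proof (cases "?A = []")
    case False
    then have "is_path V E ?A" using is_path_prefix[of V E ?A ?B] P by simp
    then have "is_path U E ?A" by (rule is_path_mono) (auto dest: set_takeWhileD)
    then show ?thesis using R by (simp add: longest_path_def)
  qed simp
  show "?B = [] \<or> hd ?B \<notin> U" using hd_dropWhile[of "\<lambda>v. v \<in> U" P] by blast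
qed

definition longest_path_length :: "'a set \<Rightarrow> ('a \<Rightarrow> 'a \<Rightarrow> bool) \<Rightarrow> nat" where
  "longest_path_length U E = Max (length ` {p. is_path U E p})"

lemma finite_path_lengths: "finite U \<Longrightarrow> finite (length ` {p. is_path U E p})"
  by (rule finite_subset[of _ "{..card U}"]) (auto simp: is_path_length_le_card)

lemma length_le_longest_path_length:
  "finite U \<Longrightarrow> is_path U E p \<Longrightarrow> length p \<le> longest_path_length U E"
  unfolding longest_path_length_def by (auto intro: Max_ge finite_path_lengths)

lemma longest_path_iff_length:
  assumes "finite U"
  shows "longest_path U E p \<longleftrightarrow> is_path U E p \<and> length p = longest_path_length U E"
proof
  assume "longest_path U E p"
  then show "is_path U E p \<and> length p = longest_path_length U E"
    unfolding longest_path_def longest_path_length_def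
    using finite_path_lengths[OF assms] by (auto intro!: Max_eqI[symmetric])
qed (auto simp: longest_path_def length_le_longest_path_length[OF assms])

subsection \<open>Components\<close>

inductive_set component :: "'a set \<Rightarrow> ('a \<Rightarrow> 'a \<Rightarrow> bool) \<Rightarrow> 'a \<Rightarrow> 'a set"
  for U E r where
  root: "r \<in> U \<Longrightarrow> r \<in> component U E r"
| step: "v \<in> component U E r \<Longrightarrow> u \<in> U \<Longrightarrow> E v u \<Longrightarrow> u \<in> component U E r"

lemma component_subset: "component U E r \<subseteq> U"
  by (auto elim: component.cases)

lemma component_subset_component:
  assumes "component U E r \<subseteq> W"
  shows "component U E r \<subseteq> component W E r"
proof
  show "v \<in> component W E r" if "v \<in> component U E r" for v
    using that
  proof induction
    case root
    then show ?case using assms by (auto intro: component.intros)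
  next
    case (step v u)
    then have "u \<in> component U E r" by (auto intro: component.intros)
    then show ?case using step assms by (auto intro: component.intros)
  qed
qed

lemma path_in_component: "is_path U E p \<Longrightarrow> set p \<subseteq> component U E (hd p)"
proof (induction p rule: rev_induct)
  case (snoc v p)
  show ?case
  proof (cases "p = []")
    case True
    then show ?thesis using snoc.prems by (simp add: is_path_def component.root)
  next
    case False
    then have "set p \<subseteq> component U E (hd p)"
      using snoc is_path_prefix by blast
    moreover have "E (last p) v" "v \<in> U"
      using snoc.prems False by (auto simp: is_path_successively successively_append_iff)
    ultimately have "v \<in> component U E (hd p)"
      using False component.step[of "last p" U E "hd p" v] last_in_set by blast
    then show ?thesis using False \<open>set p \<subseteq> component U E (hd p)\<close> by simp
  qed
qed (simp add: is_path_def)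

lemma component_crossing_from_root:
  assumes "b \<in> component U E r" "Q r" "\<not> Q b"
  shows "\<exists>x\<in>component U E r. \<exists>y\<in>component U E r. E x y \<and> Q x \<and> \<not> Q y"
  using assms by induction (auto intro: component.intros)

lemma component_path:
  assumes "v \<in> component U E r"
  shows "\<exists>p. is_path U E p \<and> hd p = r \<and> last p = v"
  using assms
proof induction
  case root
  then show ?case using is_path_singleton[of r U E] by (intro exI[of _ "[r]"]) simp
next
  case (step v u)
  then obtain p where p: "is_path U E p" "hd p = r" "last p = v" by blast
  then have "p \<noteq> []" by (simp add: is_path_def)
  show ?case
  proof (cases "u \<in> set p")
    case True
    then obtain A B where AB: "p = (A @ [u]) @ B" using split_list by fastforce
    then have "is_path U E (A @ [u])" using p(1) is_path_prefix by blast
    moreover have "hd (A @ [u]) = r" using p(2) AB by (cases A) auto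
    ultimately show ?thesis by (intro exI[of _ "A @ [u]"]) simp
  next
    case False
    then have "is_path U E (p @ [u])"
      using p step.hyps by (intro is_path_append) (auto simp: is_path_singleton)
    then show ?thesis using p(2) \<open>p \<noteq> []\<close> by (intro exI[of _ "p @ [u]"]) simp
  qed
qed

lemma component_eq_if_connected_graph:
  assumes "connected_graph U E" "r \<in> U"
  shows "component U E r = U"
proof
  show "U \<subseteq> component U E r"
  proof
    fix v assume "v \<in> U"
    then obtain p where "is_path U E p" "hd p = r" "last p = v"
      using assms unfolding connected_graph_def by blast
    then show "v \<in> component U E r"
      using path_in_component[of U E p] by (auto simp: is_path_def)
  qed
qed (rule component_subset)

lemma connected_graph_crossing:
  assumes "connected_graph U E" "a \<in> U" "b \<in> U" "Q a" "\<not> Q b"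
  shows "\<exists>x\<in>U. \<exists>y\<in>U. E x y \<and> Q x \<and> \<not> Q y"
  using component_crossing_from_root[of b U E a Q] component_eq_if_connected_graph[OF assms(1,2)]
    assms
  by simp

lemma connected_graph_singleton: "connected_graph {v} E"
  unfolding connected_graph_def by (auto intro!: exI[of _ "[v]"] simp: is_path_singleton)

lemma connected_graph_path_to_neighbour:
  assumes "connected_graph X E" "w \<in> X" "B \<noteq> [] \<Longrightarrow> \<exists>x\<in>X. E x (hd B)"
  obtains T where "is_path X E T" "hd T = w" "B \<noteq> [] \<Longrightarrow> E (last T) (hd B)"
proof -
  obtain x where x: "x \<in> X" "B \<noteq> [] \<Longrightarrow> E x (hd B)" using assms(2,3) by blast
  then obtain T where "is_path X E T" "hd T = w" "last T = x"
    using assms(1,2) unfolding connected_graph_def by blast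
  with x that show thesis by blast
qed

definition heavy_component :: "'a set \<Rightarrow> ('a \<Rightarrow> 'a \<Rightarrow> bool) \<Rightarrow> 'a set \<Rightarrow> bool" where
  "heavy_component U E C \<longleftrightarrow> (\<exists>R. longest_path U E R \<and> C = component U E (hd R))"

definition heavy_part :: "'a set \<Rightarrow> ('a \<Rightarrow> 'a \<Rightarrow> bool) \<Rightarrow> 'a set" where
  "heavy_part U E = \<Union> {C. heavy_component U E C}"

lemma heavy_component_subset: "heavy_component U E C \<Longrightarrow> C \<subseteq> U"
  by (auto simp: heavy_component_def dest: subsetD[OF component_subset])

lemma heavy_component_step:
  "heavy_component U E C \<Longrightarrow> v \<in> C \<Longrightarrow> u \<in> U \<Longrightarrow> E v u \<Longrightarrow> u \<in> C"
  unfolding heavy_component_def by (auto intro: component.step)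

lemma heavy_component_longest_path:
  assumes "heavy_component U E C"
  obtains R where "longest_path U E R" "set R \<subseteq> C"
proof -
  obtain R where R: "longest_path U E R" and C: "C = component U E (hd R)"
    using assms by (auto simp: heavy_component_def)
  then show thesis using that[OF R] path_in_component[of U E R] by (simp add: longest_path_def)
qed

lemma heavy_component_nonempty:
  assumes "heavy_component U E C"
  shows "C \<noteq> {}"
proof -
  obtain R where "longest_path U E R" "set R \<subseteq> C"
    using assms by (rule heavy_component_longest_path)
  then show ?thesis by (auto simp: longest_path_def is_path_def)
qed

lemma heavy_part_subset: "heavy_part U E \<subseteq> U"
  by (auto simp: heavy_part_def dest: heavy_component_subset)

lemma component_subset_heavy_part: "longest_path U E R \<Longrightarrow> component U E (hd R) \<subseteq> heavy_part U E"
  by (auto simp: heavy_part_def heavy_component_def)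

lemma longest_path_in_superset_of_heavy_part:
  assumes "heavy_part U E \<subseteq> W" "longest_path U E R"
  shows "is_path W E R"
proof (rule is_path_mono)
  show R: "is_path U E R" using assms(2) by (simp add: longest_path_def)
  show "set R \<subseteq> W"
    using path_in_component[OF R] component_subset_heavy_part[OF assms(2)] assms(1) by simp
qed

lemma longest_path_length_le_of_heavy_part_subset:
  assumes "finite U" "finite W" "U \<noteq> {}" "heavy_part U E \<subseteq> W"
  shows "longest_path_length U E \<le> longest_path_length W E"
proof -
  obtain R where R: "longest_path U E R" using longest_path_exists assms(1,3) by blast
  then have "length R \<le> longest_path_length W E"
    using length_le_longest_path_length[OF assms(2)]
      longest_path_in_superset_of_heavy_part[OF assms(4)] by simp
  then show ?thesis using R by (simp add: longest_path_iff_length[OF assms(1)])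
qed

lemma heavy_part_mono:
  assumes "finite U" "finite W" "heavy_part U E \<subseteq> W"
    and "longest_path_length U E = longest_path_length W E"
  shows "heavy_part U E \<subseteq> heavy_part W E"
proof
  fix v assume "v \<in> heavy_part U E"
  then obtain R where R: "longest_path U E R" and v: "v \<in> component U E (hd R)"
    by (auto simp: heavy_part_def heavy_component_def)
  have "longest_path W E R"
    using R longest_path_in_superset_of_heavy_part[OF assms(3) R] assms
    by (simp add: longest_path_iff_length)
  moreover have "component U E (hd R) \<subseteq> W"
    using component_subset_heavy_part[OF R] assms(3) by simp
  then have "v \<in> component W E (hd R)" using component_subset_component[of U E] v by auto
  ultimately show "v \<in> heavy_part W E" using component_subset_heavy_part[of W E R] by auto
qed

definition heaviness_order :: "('a \<Rightarrow> 'a \<Rightarrow> bool) \<Rightarrow> ('a set \<times> 'a set) set" where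
  "heaviness_order E = measures [\<lambda>U. longest_path_length U E, \<lambda>U. card (heavy_part U E)]"

lemma wf_heaviness_order: "wf (heaviness_order E)"
  unfolding heaviness_order_def by (rule wf_measures)

lemma heaviness_order_if_heavy_part_subset:
  assumes fin: "finite U" "finite W" and "U \<noteq> {}"
    and sub: "heavy_part U E \<subseteq> W" and x: "x \<in> heavy_part W E" "x \<notin> U"
  shows "(U, W) \<in> heaviness_order E"
proof -
  have "card (heavy_part U E) < card (heavy_part W E)"
    if "longest_path_length U E = longest_path_length W E"
  proof (rule psubset_card_mono)
    show "finite (heavy_part W E)" using finite_subset[OF heavy_part_subset] fin(2) .
    show "heavy_part U E \<subset> heavy_part W E"
      using heavy_part_mono[OF fin sub that] heavy_part_subset[of U E] x by blast
  qed
  moreover have "longest_path_length U E \<le> longest_path_length W E"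
    using longest_path_length_le_of_heavy_part_subset assms(1-4) .
  ultimately show ?thesis by (auto simp: heaviness_order_def)
qed

subsection \<open>Induced paths\<close>

definition induced_path :: "'a set \<Rightarrow> ('a \<Rightarrow> 'a \<Rightarrow> bool) \<Rightarrow> 'a list \<Rightarrow> bool" where
  "induced_path V E p \<longleftrightarrow> distinct p \<and> set p \<subseteq> V \<and>
     (\<forall>i<length p. \<forall>j<length p. E (p ! i) (p ! j) \<longleftrightarrow> i = Suc j \<or> j = Suc i)"

lemma has_induced_path_iff:
  "has_induced_path t V E \<longleftrightarrow> (\<exists>p. length p = t \<and> induced_path V E p)"
  by (auto simp: has_induced_path_def induced_path_def)

lemma induced_path_is_path: "induced_path V E p \<Longrightarrow> p \<noteq> [] \<Longrightarrow> is_path V E p"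
  by (auto simp: induced_path_def is_path_def)

locale finite_simple_graph =
  fixes V :: "'a set" and E :: "'a \<Rightarrow> 'a \<Rightarrow> bool"
  assumes simple: "simple_graph V E"
begin

lemma finite_V: "finite V" and E_sym: "E x y \<Longrightarrow> E y x" and E_irrefl: "\<not> E x x"
  and E_V: "E x y \<Longrightarrow> x \<in> V \<and> y \<in> V"
  using simple unfolding simple_graph_def by blast+

lemma E_commute: "E x y \<longleftrightarrow> E y x"
  using E_sym by blast

lemma induced_path_singleton: "v \<in> V \<Longrightarrow> induced_path V E [v]"
  by (simp add: induced_path_def E_irrefl)

lemma induced_path_snoc:
  assumes p: "induced_path V E p" and v: "v \<in> V" "v \<notin> set p"
    and adj: "\<And>u. u \<in> set p \<Longrightarrow> E u v \<longleftrightarrow> u = last p"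
  shows "induced_path V E (p @ [v])"
proof -
  have end_adj: "E (p ! i) v \<longleftrightarrow> length p = Suc i" if "i < length p" for i
  proof -
    have "E (p ! i) v \<longleftrightarrow> p ! i = p ! (length p - 1)"
      using that adj[of "p ! i"] by (cases "p = []") (simp_all add: last_conv_nth)
    also have "\<dots> \<longleftrightarrow> length p = Suc i"
      using that p nth_eq_iff_index_eq[of p i "length p - 1"] by (auto simp: induced_path_def)
    finally show ?thesis .
  qed
  have "E ((p @ [v]) ! i) ((p @ [v]) ! j) \<longleftrightarrow> i = Suc j \<or> j = Suc i"
    if "i < Suc (length p)" "j < Suc (length p)" for i j
    using that p end_adj[of i] end_adj[of j] E_irrefl E_commute[of v]
    by (auto simp: induced_path_def nth_append less_Suc_eq)
  then show ?thesis using p v by (auto simp: induced_path_def)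
qed

lemma induced_path_through_mixed_edge:
  assumes "k \<in> {2, 3}" and edges: "E d x" "E x w" "\<not> E d w" "d \<noteq> w"
  obtains Q where "induced_path V E Q" "length Q = k" "last Q = w" "set (butlast Q) \<subseteq> {x, d}"
proof -
  have V: "d \<in> V" "x \<in> V" "w \<in> V" and neq: "d \<noteq> x" "x \<noteq> w"
    using edges E_V E_irrefl by blast+
  have "induced_path V E ([x] @ [w])" and dx: "induced_path V E ([d] @ [x])"
    using edges V neq by (intro induced_path_snoc induced_path_singleton; simp)+
  moreover have "induced_path V E (([d] @ [x]) @ [w])"
    using dx by (rule induced_path_snoc) (use edges V neq in auto)
  ultimately have "induced_path V E [x, w]" "induced_path V E [d, x, w]" by simp_all
  then show thesis
    using that[of "[x, w]"] that[of "[d, x, w]"] assms(1) by auto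
qed

subsection \<open>Connected sets\<close>

lemma component_crossing:
  assumes "a \<in> component U E r" "b \<in> component U E r" "Q a" "\<not> Q b"
  shows "\<exists>x\<in>component U E r. \<exists>y\<in>component U E r. E x y \<and> Q x \<and> \<not> Q y"
proof (cases "Q r")
  case True
  then show ?thesis using component_crossing_from_root[of b U E r Q] assms by blast
next
  case False
  then show ?thesis
    using component_crossing_from_root[of a U E r "\<lambda>v. \<not> Q v"] assms E_sym by blast
qed

lemma connected_graph_if_component_eq:
  assumes "r \<in> U" "component U E r = U"
  shows "connected_graph U E"
proof -
  have "v \<in> component U E u" if uv: "u \<in> U" "v \<in> U" for u v
  proof (rule ccontr)
    assume "v \<notin> component U E u"
    then obtain x y where "x \<in> component U E u" "y \<in> U" "E x y" "y \<notin> component U E u"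
      using component_crossing[of u U r v "\<lambda>x. x \<in> component U E u"] component.root[OF uv(1)]
        uv assms(2) by auto
    then show False using component.step by metis
  qed
  then show ?thesis using assms(1) component_path by (fastforce simp: connected_graph_def)
qed

lemma connected_graph_insert:
  assumes S: "connected_graph S E" and s: "s \<in> S" "E w s"
  shows "connected_graph (insert w S) E"
proof (rule connected_graph_if_component_eq)
  have "S \<subseteq> component (insert w S) E s"
    using component_subset_component[of S E s "insert w S"]
      component_eq_if_connected_graph[OF S s(1)] by blast
  moreover from this have "w \<in> component (insert w S) E s"
    using s(1) E_sym[OF s(2)] by (auto intro: component.step[of s])
  ultimately show "component (insert w S) E s = insert w S"
    using component_subset[of "insert w S" E s] by blast
qed (use s(1) in simp)

lemma connected_graph_path: "is_path V E p \<Longrightarrow> connected_graph (set p) E"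
proof (induction p)
  case (Cons v p)
  show ?case
  proof (cases "p = []")
    case True
    then show ?thesis by (simp add: connected_graph_singleton)
  next
    case False
    then have "is_path V E p" "E v (hd p)"
      using Cons.prems by (auto simp: is_path_successively successively_Cons)
    then show ?thesis
      using connected_graph_insert[OF Cons.IH, of "hd p" v] False by simp
  qed
qed (simp add: is_path_def)

subsection \<open>Transversals from connected sets\<close>

lemma dominating_set_transversal:
  assumes "S \<subseteq> V" and dominating: "\<And>v. v \<in> V - S \<Longrightarrow> \<exists>s\<in>S. E s v"
  shows "lp_transversal V E S"
  unfolding lp_transversal_def
proof (intro conjI allI impI notI)
  fix P assume P: "longest_path V E P" and miss: "set P \<inter> S = {}"
  have "hd P \<in> set P" "set P \<subseteq> V" using P by (auto simp: longest_path_def is_path_def)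
  then have "hd P \<in> V - S" using miss by blast
  then obtain s where s: "s \<in> S" "E s (hd P)" using dominating by blast
  then have "length [s] \<le> length ([] :: 'a list)"
    using P miss assms(1)
    by (intro longest_path_exchange[of V E "[]" "[]" P]) (auto simp: is_path_singleton)
  then show False by simp
qed (fact assms(1))

lemma longest_path_leaves_neighbour:
  assumes X: "X \<subseteq> V" "connected_graph X E" "w \<in> X"
    and P: "longest_path V E (A @ v # B)" "set (A @ v # B) \<inter> X = {}" and "E v w"
  shows "B \<noteq> [] \<and> (\<forall>x\<in>X. \<not> E x (hd B))"
proof (rule ccontr)
  assume "\<not> ?thesis"
  then obtain T where T: "is_path X E T" "hd T = w" "B \<noteq> [] \<Longrightarrow> E (last T) (hd B)"
    using connected_graph_path_to_neighbour[OF X(2,3), of B] by blast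
  then have TX: "set T \<subseteq> X" "T \<noteq> []" by (auto simp: is_path_def)
  have "length T \<le> length ([] :: 'a list)"
  proof (rule longest_path_exchange)
    show "longest_path V E ((A @ [v]) @ [] @ B)" using P(1) by simp
    show "is_path V E T" using T(1) by (rule is_path_mono) (use TX X in blast)
  qed (use T TX P \<open>E v w\<close> in auto)
  then show False using TX by simp
qed

lemma longest_path_avoids_complete_set:
  assumes X: "X \<subseteq> V" "connected_graph X E" "w \<in> X"
    and P: "longest_path V E P" "set P \<inter> X = {}"
    and complete: "\<And>v. v \<in> D \<Longrightarrow> E w v"
    and boundary: "\<And>v u. v \<in> D \<Longrightarrow> u \<in> V - X - D \<Longrightarrow> E v u \<Longrightarrow> \<exists>x\<in>X. E x u"
  shows "set P \<inter> D = {}"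
proof (rule ccontr)
  assume "set P \<inter> D \<noteq> {}"
  then obtain v A B where v: "v \<in> D" and AB: "P = A @ v # B"
    by (meson disjoint_iff split_list)
  have B: "B \<noteq> []" "\<And>x. x \<in> X \<Longrightarrow> \<not> E x (hd B)"
    using longest_path_leaves_neighbour[OF X, of A v B] P complete[OF v] E_sym AB by auto
  have "E v (hd B)"
    using P(1) B(1) AB
    by (auto simp: longest_path_def is_path_successively successively_append_iff successively_Cons)
  moreover from this have "hd B \<in> V - X"
    using E_V P(2) AB hd_in_set[OF B(1)] by auto
  ultimately show False using complete boundary[OF v, of "hd B"] B(2) X(3) by blast
qed

lemma complete_attachment_transversal:
  assumes X: "X \<subseteq> V" "connected_graph X E" "w \<in> X"
    and U: "U \<subseteq> V - X" "\<And>z. z \<in> V - X - U \<Longrightarrow> \<exists>x\<in>X. E x z"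
    and D: "heavy_component U E D" and complete: "\<And>v. v \<in> D \<Longrightarrow> E w v"
  shows "lp_transversal V E X"
  unfolding lp_transversal_def
proof (intro conjI allI impI notI)
  fix P assume P: "longest_path V E P" and miss: "set P \<inter> X = {}"
  have disj: "set P \<inter> D = {}"
    using X P miss complete
  proof (rule longest_path_avoids_complete_set)
    show "\<exists>x\<in>X. E x u" if "v \<in> D" "u \<in> V - X - D" "E v u" for v u
      using that U(2) heavy_component_step[OF D] by blast
  qed
  obtain R where R: "longest_path U E R" "set R \<subseteq> D" using D by (rule heavy_component_longest_path)
  have pP: "is_path V E P" using P by (simp add: longest_path_def)
  obtain A B where AB: "P = A @ B" and A_le: "length A \<le> length R"
    and exit: "B = [] \<or> hd B \<notin> U"
    using path_split_at_exit[OF pP R(1)] .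
  have "\<exists>x\<in>X. E x (hd B)" if "B \<noteq> []"
  proof -
    have "hd B \<in> set P" "set P \<subseteq> V - X" using that AB pP miss by (auto simp: is_path_def)
    then show ?thesis using exit that U(2) by blast
  qed
  then obtain T where T: "is_path X E T" "hd T = w" "B \<noteq> [] \<Longrightarrow> E (last T) (hd B)"
    using connected_graph_path_to_neighbour[OF X(2,3)] by blast
  have TX: "set T \<subseteq> X" "T \<noteq> []" using T(1) by (auto simp: is_path_def)
  have RU: "is_path U E R" using R(1) by (simp add: longest_path_def)
  then have "set R \<subseteq> U" "R \<noteq> []" by (auto simp: is_path_def)
  have "is_path V E (R @ T)"
  proof (rule is_path_append)
    show "is_path V E R" using RU by (rule is_path_mono) (use \<open>set R \<subseteq> U\<close> U in blast)
    show "is_path V E T" using T(1) by (rule is_path_mono) (use TX X in blast)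
    show "set R \<inter> set T = {}" using \<open>set R \<subseteq> U\<close> TX U by blast
    show "E (last R) (hd T)" using complete E_sym R(2) \<open>R \<noteq> []\<close> T(2) by (simp add: subset_iff)
  qed
  then have "length (R @ T) \<le> length A"
    by (rule longest_path_exchange[of V E "[]" A B, rotated])
      (use P T TX miss disj R \<open>R \<noteq> []\<close> AB in auto)
  then show False using A_le TX(2) by (simp flip: length_greater_0_conv)
qed (fact X(1))

subsection \<open>Heavy components outside a connected set\<close>

definition nonneighbours :: "'a set \<Rightarrow> 'a set" where
  "nonneighbours S = {v \<in> V - S. \<forall>s\<in>S. \<not> E s v}"

lemma finite_nonneighbours: "finite (nonneighbours S)"
  by (rule finite_subset[OF _ finite_V]) (auto simp: nonneighbours_def)

lemma nonneighbours_empty_transversal: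
  "S \<subseteq> V \<Longrightarrow> nonneighbours S = {} \<Longrightarrow> lp_transversal V E S"
  by (rule dominating_set_transversal) (auto simp: nonneighbours_def)

lemma heavy_component_attachment:
  assumes "connected_graph V E" and S: "S \<subseteq> V" "S \<noteq> {}"
    and D: "heavy_component (nonneighbours S) E D"
  obtains w a s where "w \<in> V - D" "a \<in> D" "E w a" "s \<in> S" "E w s"
proof -
  have DU: "D \<subseteq> nonneighbours S" using heavy_component_subset[OF D] .
  then have "D \<subseteq> V" "S \<inter> D = {}" by (auto simp: nonneighbours_def)
  then obtain a w where aw: "a \<in> D" "w \<in> V - D" "E a w"
    using connected_graph_crossing[OF assms(1), where Q = "\<lambda>v. v \<in> D"]
      heavy_component_nonempty[OF D] S by blast
  have "w \<notin> nonneighbours S" using heavy_component_step[OF D] aw by blast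
  moreover have "w \<notin> S" using aw DU by (auto simp: E_commute nonneighbours_def)
  ultimately obtain s where "s \<in> S" "E w s" using aw E_sym by (auto simp: nonneighbours_def)
  then show thesis using that aw E_sym by blast
qed

lemma heavy_component_mixed_edge:
  assumes S: "S \<subseteq> V" "connected_graph S E" and D: "heavy_component (nonneighbours S) E D"
    and no: "\<not> lp_transversal V E (insert w S)"
    and w: "s \<in> S" "E w s" "a \<in> D" "E w a"
  obtains x y where "x \<in> D" "y \<in> D" "E x y" "E w x" "\<not> E w y"
proof -
  have "\<not> (\<forall>v\<in>D. E w v)"
  proof
    assume complete: "\<forall>v\<in>D. E w v"
    have "lp_transversal V E (insert w S)"
    proof (rule complete_attachment_transversal[where w = w, OF _ _ _ _ _ D])
      show "insert w S \<subseteq> V" using S(1) E_V[OF w(2)] by simp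
      show "connected_graph (insert w S) E" using connected_graph_insert[OF S(2) w(1,2)] .
      show "nonneighbours S \<subseteq> V - insert w S"
        using w(1) E_sym[OF w(2)] by (auto simp: nonneighbours_def)
      show "\<exists>x\<in>insert w S. E x z" if "z \<in> V - insert w S - nonneighbours S" for z
        using that by (auto simp: nonneighbours_def)
    qed (use complete in auto)
    with no show False ..
  qed
  then obtain b where "b \<in> D" "\<not> E w b" by blast
  moreover obtain R where "D = component (nonneighbours S) E (hd R)"
    using D by (auto simp: heavy_component_def)
  ultimately show thesis using component_crossing[of a _ "hd R" b "E w"] w(3,4) that by blast
qed

lemma has_induced_path_append_mixed_edge:
  assumes Q: "induced_path V E Q" "Q \<noteq> []"
    and \<sigma>: "\<sigma> \<notin> set Q" "\<And>u. u \<in> set Q \<Longrightarrow> E u \<sigma> \<longleftrightarrow> u = last Q"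
    and y: "y \<in> nonneighbours (set Q)" "y' \<in> nonneighbours (set Q)"
      "E \<sigma> y" "E y y'" "\<not> E \<sigma> y'"
  shows "has_induced_path (length Q + 3) V E"
proof -
  have V: "\<sigma> \<in> V" "y \<in> V" "y' \<in> V" using y E_V by blast+
  have "E (last Q) \<sigma>" using \<sigma>(2) Q(2) by simp
  then have "\<sigma> \<notin> nonneighbours (set Q)" using Q(2) by (auto simp: nonneighbours_def)
  then have neq: "y \<noteq> \<sigma>" "y' \<noteq> y" "y' \<noteq> \<sigma>" using y E_irrefl by blast+
  have "induced_path V E (Q @ [\<sigma>])" using Q \<sigma> V by (intro induced_path_snoc) auto
  then have "induced_path V E ((Q @ [\<sigma>]) @ [y])"
    by (rule induced_path_snoc) (use \<sigma> y V neq in \<open>auto simp: nonneighbours_def\<close>)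
  then have "induced_path V E (((Q @ [\<sigma>]) @ [y]) @ [y'])"
    by (rule induced_path_snoc) (use y V neq in \<open>auto simp: nonneighbours_def\<close>)
  then show ?thesis unfolding has_induced_path_iff
    by (intro exI[of _ "Q @ [\<sigma>, y, y']"]) simp
qed

lemma nonadjacent_heavy_component:
  assumes free: "P_free (length Q + 3) V E"
    and Q: "induced_path V E Q" "Q \<noteq> []"
    and no: "\<not> lp_transversal V E (insert \<sigma> (set Q))"
    and F: "heavy_component (nonneighbours (set Q)) E F" "f \<in> F"
    and \<sigma>: "\<sigma> \<notin> F" "\<And>u. u \<in> set (butlast Q) \<Longrightarrow> \<not> E u \<sigma>"
  shows "\<not> E \<sigma> f"
proof
  assume "E \<sigma> f"
  have FU: "F \<subseteq> nonneighbours (set Q)" using heavy_component_subset[OF F(1)] .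
  have QV: "set Q \<subseteq> V" "connected_graph (set Q) E"
    using Q connected_graph_path[OF induced_path_is_path] by (auto simp: induced_path_def)
  have "\<sigma> \<notin> set Q" using \<open>E \<sigma> f\<close> F(2) FU by (auto simp: nonneighbours_def)
  moreover have "\<sigma> \<notin> nonneighbours (set Q)"
    using heavy_component_step[OF F] \<sigma>(1) \<open>E \<sigma> f\<close> E_sym by blast
  ultimately obtain q where q: "q \<in> set Q" "E q \<sigma>"
    using E_V[OF \<open>E \<sigma> f\<close>] by (auto simp: nonneighbours_def)
  have only_last: "u = last Q" if "u \<in> set Q" "E u \<sigma>" for u
  proof -
    have "u \<in> set (butlast Q @ [last Q])"
      unfolding append_butlast_last_id[OF Q(2)] by (fact that(1))
    then show ?thesis using \<sigma>(2) that(2) by auto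
  qed
  have "E u \<sigma> \<longleftrightarrow> u = last Q" if "u \<in> set Q" for u
    using only_last[OF that] only_last[OF q] q(2) by blast
  moreover obtain y y' where "y \<in> F" "y' \<in> F" "E y y'" "E \<sigma> y" "\<not> E \<sigma> y'"
    using heavy_component_mixed_edge[OF QV F(1) no q(1) E_sym[OF q(2)] F(2) \<open>E \<sigma> f\<close>] .
  ultimately have "has_induced_path (length Q + 3) V E"
    using has_induced_path_append_mixed_edge[OF Q \<open>\<sigma> \<notin> set Q\<close>, of y y'] FU by blast
  with free show False by (simp add: P_free_def)
qed

lemma heavy_component_subset_nonneighbours:
  assumes free: "P_free (length Q + 3) V E"
    and S: "connected_graph S E" "s \<in> S" "E (last Q) s"
    and Q: "induced_path V E Q" "Q \<noteq> []" "set (butlast Q) \<subseteq> nonneighbours S"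
    and no: "\<And>\<sigma>. \<not> lp_transversal V E (insert \<sigma> (set Q))"
    and F: "heavy_component (nonneighbours (set Q)) E F"
  shows "F \<subseteq> nonneighbours S"
proof -
  have nonadjacent: "\<not> E \<sigma> f" if "\<sigma> \<in> S - F" "f \<in> F" for \<sigma> f
  proof (rule nonadjacent_heavy_component[OF free Q(1,2) no F \<open>f \<in> F\<close>])
    show "\<not> E u \<sigma>" if "u \<in> set (butlast Q)" for u
      using that Q(3) \<open>\<sigma> \<in> S - F\<close> E_sym by (auto simp: nonneighbours_def)
  qed (use that in blast)
  have FU: "F \<subseteq> nonneighbours (set Q)" using heavy_component_subset[OF F] .
  then have "s \<notin> F" using S(3) Q(2) by (auto simp: nonneighbours_def)
  have "S \<inter> F = {}"
  proof (rule ccontr)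
    assume "S \<inter> F \<noteq> {}"
    then obtain f where "f \<in> S" "f \<in> F" by blast
    then obtain x y where "x \<in> F" "y \<in> S - F" "E x y"
      using connected_graph_crossing[OF S(1) _ S(2), of f "\<lambda>v. v \<in> F"] \<open>s \<notin> F\<close> by blast
    then show False using nonadjacent E_sym by blast
  qed
  then show ?thesis using nonadjacent FU by (auto simp: nonneighbours_def)
qed

lemma heavy_component_attached_induced_path:
  assumes k: "k \<in> {2, 3}" and conn: "connected_graph V E"
    and S: "S \<subseteq> V" "connected_graph S E" and D: "heavy_component (nonneighbours S) E D"
    and no: "\<And>w. \<not> lp_transversal V E (insert w S)"
  obtains Q s where "induced_path V E Q" "length Q = k" "set (butlast Q) \<subseteq> D"
    "s \<in> S" "E (last Q) s"
proof -
  have "S \<noteq> {}" using S(2) by (simp add: connected_graph_def)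
  then obtain w a s where w: "w \<in> V - D" "a \<in> D" "E w a" "s \<in> S" "E w s"
    using heavy_component_attachment[OF conn S(1) _ D] by blast
  obtain x d where xd: "x \<in> D" "d \<in> D" "E x d" "E w x" "\<not> E w d"
    using heavy_component_mixed_edge[OF S D no w(4,5,2,3)] .
  have "E d x" "E x w" "\<not> E d w" "d \<noteq> w" using xd w(1) E_sym by blast+
  then obtain Q where Q: "induced_path V E Q" "length Q = k" "last Q = w"
    and "set (butlast Q) \<subseteq> {x, d}"
    by (rule induced_path_through_mixed_edge[OF k])
  with xd(1,2) have "set (butlast Q) \<subseteq> D" by blast
  then show thesis using that[OF Q(1,2) _ w(4)] Q(3) w(5) by simp
qed

definition small_connected_set :: "nat \<Rightarrow> 'a set \<Rightarrow> bool" where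
  "small_connected_set k S \<longleftrightarrow> S \<subseteq> V \<and> connected_graph S E \<and> card S \<le> k"

lemma lighter_connected_set_exists:
  assumes k: "k \<in> {2, 3}" "P_free (k + 3) V E" and conn: "connected_graph V E"
    and no: "\<nexists>X. lp_transversal V E X \<and> card X \<le> k + 1"
    and S: "small_connected_set k S"
  obtains S' where "small_connected_set k S'"
    "(nonneighbours S', nonneighbours S) \<in> heaviness_order E"
proof -
  have no_insert: "\<not> lp_transversal V E (insert w T)" if "card T \<le> k" for w T
    using no card_insert_le_m1[of "k + 1" T w] that by auto
  have nonempty: "nonneighbours T \<noteq> {}" if "small_connected_set k T" for T
    using nonneighbours_empty_transversal[of T] no that by (auto simp: small_connected_set_def)
  have SV: "S \<subseteq> V" "connected_graph S E" "card S \<le> k"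
    using S by (auto simp: small_connected_set_def)
  obtain D where D: "heavy_component (nonneighbours S) E D"
    using longest_path_exists[OF finite_nonneighbours nonempty[OF S]]
    unfolding heavy_component_def by blast
  obtain Q s where Q: "induced_path V E Q" "length Q = k" "set (butlast Q) \<subseteq> D"
    and s: "s \<in> S" "E (last Q) s"
    using heavy_component_attached_induced_path[OF k(1) conn SV(1,2) D no_insert[OF SV(3)]] .
  have "Q \<noteq> []" "butlast Q \<noteq> []" using Q(2) k(1) by (auto simp flip: length_0_conv)
  have small: "small_connected_set k (set Q)"
    using Q connected_graph_path[OF induced_path_is_path[OF Q(1) \<open>Q \<noteq> []\<close>]]
    by (auto simp: small_connected_set_def induced_path_def distinct_card)
  have "(nonneighbours (set Q), nonneighbours S) \<in> heaviness_order E"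
  proof (rule heaviness_order_if_heavy_part_subset[OF _ _ nonempty[OF small]])
    have "F \<subseteq> nonneighbours S" if "heavy_component (nonneighbours (set Q)) E F" for F
      using heavy_component_subset_nonneighbours[OF _ SV(2) s Q(1) \<open>Q \<noteq> []\<close> _ _ that]
        Q(2,3) heavy_component_subset[OF D] k(2) no_insert[of "set Q"] card_length[of Q] by auto
    then show "heavy_part (nonneighbours (set Q)) E \<subseteq> nonneighbours S"
      by (auto simp: heavy_part_def)
    have "hd (butlast Q) \<in> D" using Q(3) \<open>butlast Q \<noteq> []\<close> by auto
    then show "hd (butlast Q) \<in> heavy_part (nonneighbours S) E"
      using D unfolding heavy_part_def by blast
    show "hd (butlast Q) \<notin> nonneighbours (set Q)"
      using \<open>butlast Q \<noteq> []\<close> by (auto simp: nonneighbours_def dest: in_set_butlastD hd_in_set)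
  qed (fact finite_nonneighbours)+
  with small that show thesis by blast
qed

lemma small_transversal_exists:
  assumes k: "k \<in> {2, 3}" "P_free (k + 3) V E" and conn: "connected_graph V E"
  shows "\<exists>X. lp_transversal V E X \<and> card X \<le> k + 1"
proof (rule ccontr)
  assume no: "\<not> ?thesis"
  have "wf (inv_image (heaviness_order E) nonneighbours)"
    by (intro wf_inv_image wf_heaviness_order)
  then have none: "\<not> small_connected_set k S" for S
  proof (induction S rule: wf_induct_rule)
    case (less S)
    show ?case
    proof
      assume "small_connected_set k S"
      then obtain S' where "small_connected_set k S'"
        "(nonneighbours S', nonneighbours S) \<in> heaviness_order E"
        by (rule lighter_connected_set_exists[OF k conn no])
      then show False using less.IH[of S'] by (simp add: in_inv_image)
    qed
  qed
  obtain v where "v \<in> V" using conn by (auto simp: connected_graph_def)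
  then have "small_connected_set k {v}"
    using k(1) by (auto simp: small_connected_set_def connected_graph_singleton)
  then show False using none by blast
qed

end

lemma lpt_le_card: "lp_transversal V E S \<Longrightarrow> lpt V E \<le> card S"
  unfolding lpt_def by (rule Least_le) blast

theorem theorem3p4:
  fixes V :: "'a set" and E :: "'a \<Rightarrow> 'a \<Rightarrow> bool" and t :: nat
  assumes "t \<in> {5, 6}"
    and "simple_graph V E"
    and "connected_graph V E"
    and "P_free t V E"
  shows "lpt V E \<le> t - 2"
proof -
  interpret finite_simple_graph V E using assms(2) by unfold_locales
  have "t - 3 \<in> {2, 3}" "t - 3 + 3 = t" "t - 3 + 1 = t - 2" using assms(1) by auto
  then obtain X where "lp_transversal V E X" "card X \<le> t - 2"
    using small_transversal_exists[of "t - 3"] assms(3,4) by auto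
  then show ?thesis using lpt_le_card order_trans by blast
qed

end
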